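(* Let $E$ be a Banach space and let $\mathcal T=(T_i)_{i\in I}$ be a net of bounded linear operators on $E$ such that the directed set $I$ contains a countable majorizing subset. Let $V$ be an operator range in $E$, endowed with a complete norm $\|\cdot\|_V$ that makes the embedding of $V$ into $E$ continuous. The following assertions are equivalent: (i) The space $V$ is uniformly eventually invariant under $\mathcal T$, i.e. there exists $i_0\in I$ such that $T_iV\subseteq V$ for all $i\ge i_0$. (ii) There are numbers $c_i\ge 0$ for all $i\in I$ with the following property: for each $v\in V$ there exists $i_0\in I$ such that $T_iv\in V$ and $\|T_iv\|_V\le c_i\|v\|_V$ for all $i\ge i_0$.
   Context: Banach spaces are real or complex. A subset $B$ of a directed set $(A,\le)$ is majorizing if for each $a\in A$ there exists $b\in B$ with $a\le b$. A vector subspace $V$ of a Banach space $E$ is called an operator range in $E$ if there exists a complete norm $\|\cdot\|_V$ on $V$ that makes the embedding of $V$ into $E$ continuous (such a norm is unique up to equivalence). *)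

theory Defs
  imports "HOL-Analysis.Analysis"
begin

(*
  Real and complex Banach spaces are treated together. The scalars are of a type
  'k :: {real_normed_field, banach}; real and complex are instances and, by Gelfand-Mazur,
  up to isometric isomorphism the only ones. Class banach of the library only knows real
  scalars, so the multiplication by scalars in 'k is an explicit function compatible with the
  norm and with the underlying real structure.
*)

definition banach_space_over :: "('k::{real_normed_field,banach} \<Rightarrow> 'a::banach \<Rightarrow> 'a) \<Rightarrow> bool" where
  "banach_space_over smul \<longleftrightarrow>
     vector_space smul \<and>
     (\<forall>r x. smul (of_real r) x = r *\<^sub>R x) \<and>
     (\<forall>c x. norm (smul c x) = norm c * norm x)"

definition bounded_operator_over ::
  "('k::{real_normed_field,banach} \<Rightarrow> 'a::banach \<Rightarrow> 'a) \<Rightarrow> ('a \<Rightarrow> 'a) \<Rightarrow> bool" where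
  "bounded_operator_over smul f \<longleftrightarrow>
     Vector_Spaces.linear smul smul f \<and> (\<exists>C. \<forall>x. norm (f x) \<le> C * norm x)"

definition directed_set :: "'i set \<Rightarrow> ('i \<Rightarrow> 'i \<Rightarrow> bool) \<Rightarrow> bool" where
  "directed_set A le \<longleftrightarrow>
     A \<noteq> {} \<and> reflp_on A le \<and> transp_on A le \<and>
     (\<forall>a\<in>A. \<forall>b\<in>A. \<exists>c\<in>A. le a c \<and> le b c)"

definition majorizing :: "'i set \<Rightarrow> ('i \<Rightarrow> 'i \<Rightarrow> bool) \<Rightarrow> 'i set \<Rightarrow> bool" where
  "majorizing A le B \<longleftrightarrow> B \<subseteq> A \<and> (\<forall>a\<in>A. \<exists>b\<in>B. le a b)"

(* Values of N outside V are irrelevant here and in everything below. *)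
definition norm_on ::
  "('k::{real_normed_field,banach} \<Rightarrow> 'a::banach \<Rightarrow> 'a) \<Rightarrow> 'a set \<Rightarrow> ('a \<Rightarrow> real) \<Rightarrow> bool" where
  "norm_on smul V N \<longleftrightarrow>
     (\<forall>v\<in>V. 0 \<le> N v) \<and>
     (\<forall>v\<in>V. N v = 0 \<longleftrightarrow> v = 0) \<and>
     (\<forall>c. \<forall>v\<in>V. N (smul c v) = norm c * N v) \<and>
     (\<forall>u\<in>V. \<forall>v\<in>V. N (u + v) \<le> N u + N v)"

(*
  The metric on V induced by N. The locale Metric_space demands nonnegativity and symmetry on
  the whole type, not just on the carrier, hence the value 0 outside V.
*)
definition norm_dist :: "'a::banach set \<Rightarrow> ('a \<Rightarrow> real) \<Rightarrow> 'a \<Rightarrow> 'a \<Rightarrow> real" where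
  "norm_dist V N u v = (if u \<in> V \<and> v \<in> V then N (u - v) else 0)"

definition complete_norm_on ::
  "('k::{real_normed_field,banach} \<Rightarrow> 'a::banach \<Rightarrow> 'a) \<Rightarrow> 'a set \<Rightarrow> ('a \<Rightarrow> real) \<Rightarrow> bool" where
  "complete_norm_on smul V N \<longleftrightarrow>
     norm_on smul V N \<and> Metric_space.mcomplete V (norm_dist V N)"

definition embedding_continuous :: "'a::banach set \<Rightarrow> ('a \<Rightarrow> real) \<Rightarrow> bool" where
  "embedding_continuous V N \<longleftrightarrow>
     continuous_map (Metric_space.mtopology V (norm_dist V N)) euclidean (\<lambda>v. v)"

definition operator_range ::
  "('k::{real_normed_field,banach} \<Rightarrow> 'a::banach \<Rightarrow> 'a) \<Rightarrow> 'a set \<Rightarrow> bool" where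
  "operator_range smul V \<longleftrightarrow>
     module.subspace smul V \<and>
     (\<exists>N. complete_norm_on smul V N \<and> embedding_continuous V N)"

definition uniformly_eventually_invariant ::
  "'i set \<Rightarrow> ('i \<Rightarrow> 'i \<Rightarrow> bool) \<Rightarrow> ('i \<Rightarrow> 'a \<Rightarrow> 'a) \<Rightarrow> 'a set \<Rightarrow> bool" where
  "uniformly_eventually_invariant I le T V \<longleftrightarrow>
     (\<exists>i0\<in>I. \<forall>i\<in>I. le i0 i \<longrightarrow> T i ` V \<subseteq> V)"

lemma Metric_space_norm_dist:
  fixes smul :: "'k::{real_normed_field,banach} \<Rightarrow> 'a::banach \<Rightarrow> 'a"
  assumes "banach_space_over smul" "module.subspace smul V" "norm_on smul V N"
  shows "Metric_space V (norm_dist V N)"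
proof -
  interpret vector_space smul
    using assms(1) by (simp add: banach_space_over_def)
  have diff: "u - v \<in> V" if "u \<in> V" "v \<in> V" for u v
    using subspace_diff[OF assms(2)] that by blast
  have nonneg: "0 \<le> N v" and zero: "N v = 0 \<longleftrightarrow> v = 0"
    and homog: "N (smul c v) = norm c * N v" if "v \<in> V" for v c
    using assms(3) that unfolding norm_on_def by simp_all
  have tri: "N (u + v) \<le> N u + N v" if "u \<in> V" "v \<in> V" for u v
    using assms(3) that unfolding norm_on_def by simp
  have sym: "N (u - v) = N (v - u)" if "u \<in> V" "v \<in> V" for u v
    using homog[OF diff[OF that(2,1)], of "- 1"] by simp
  show ?thesis
  proof (unfold_locales, goal_cases)
    case (1 x y)
    show ?case by (simp add: norm_dist_def nonneg diff)
  next
    case (2 x y)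
    show ?case using sym[of x y] by (simp add: norm_dist_def)
  next
    case (3 x y)
    then show ?case by (simp add: norm_dist_def zero diff)
  next
    case (4 x y z)
    then show ?case
      using tri[of "x - y" "y - z"] by (simp add: norm_dist_def diff)
  qed
qed

end

theory Submission
  imports Defs
begin

text \<open>
  Both directions rest on one fact of open-mapping type. Suppose that for every v in V some index
  n and some constant m satisfy T i v \<in> V and N (T i v) \<le> m * w i for all i in J n. The
  sets A n m of all v with this property are convex and symmetric, and countably many of them
  cover V, so by Baire the closure of one of them contains a ball around 0. Small vectors of V are
  then series of the form \<Sum>k. a k / 2 ^ k with a k in A n m. Applying T i termwise, the
  completeness of V and the continuity of T i on E yield T i v \<in> V with a norm bound
  on the ball. For (i) implies (ii) take J n = {i} and w i = 1, which gives the
  boundedness of each T i on V; for (ii) implies (i) let J n consist of the indices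
  above the n-th majorizing element and take w i = c i.
\<close>

section \<open>A complete norm on a subspace with continuous embedding\<close>

text \<open>Only real scalars occur here: the category argument uses nothing but the underlying real
  structure, so real and complex spaces are treated at once.\<close>

locale embedded_banach =
  fixes V :: "'a::banach set" and N :: "'a \<Rightarrow> real"
  assumes subspace_V: "subspace V"
    and complete_norm: "complete_norm_on (*\<^sub>R) V N"
    and embedding: "embedding_continuous V N"
begin

sublocale Metric_space V "norm_dist V N"
proof (rule Metric_space_norm_dist)
  show "banach_space_over ((*\<^sub>R) :: real \<Rightarrow> 'a \<Rightarrow> 'a)"
    by (simp add: banach_space_over_def real_vector.vector_space_axioms)
  show "module.subspace (*\<^sub>R) V"
    using subspace_V by (simp add: subspace_raw_def)
  show "norm_on (*\<^sub>R) V N"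
    using complete_norm by (simp add: complete_norm_on_def)
qed

lemma mcomplete: mcomplete
  using complete_norm by (simp add: complete_norm_on_def)

lemma norm_nonneg: "v \<in> V \<Longrightarrow> 0 \<le> N v"
  and norm_eq_0: "v \<in> V \<Longrightarrow> N v = 0 \<longleftrightarrow> v = 0"
  and norm_scaleR: "v \<in> V \<Longrightarrow> N (r *\<^sub>R v) = \<bar>r\<bar> * N v"
  and norm_triangle: "u \<in> V \<Longrightarrow> v \<in> V \<Longrightarrow> N (u + v) \<le> N u + N v"
  using complete_norm by (simp_all add: complete_norm_on_def norm_on_def)

lemma norm_triangle_diff:
  assumes "u \<in> V" "v \<in> V"
  shows "N (u - v) \<le> N u + N v"
  using norm_triangle[of u "- v"] norm_scaleR[of v "-1"] assms subspace_V
  by (simp add: subspace_neg)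

lemma norm_sum_le:
  assumes "\<And>k. k \<in> K \<Longrightarrow> f k \<in> V"
  shows "N (sum f K) \<le> (\<Sum>k\<in>K. N (f k))"
  using assms
proof (induction K rule: infinite_finite_induct)
  case (insert x F)
  then show ?case
    using norm_triangle[of "f x" "sum f F"] subspace_sum[OF subspace_V, of F f] by simp
qed (use norm_eq_0[of 0] subspace_0[OF subspace_V] in auto)

lemma limitin_iff:
  "limitin mtopology s v sequentially \<longleftrightarrow>
    v \<in> V \<and> (\<forall>e>0. \<exists>M. \<forall>n\<ge>M. s n \<in> V \<and> N (s n - v) < e)"
  by (simp add: limit_metric_sequentially norm_dist_def cong: conj_cong)

text \<open>The continuity of the embedding enters the analysis only through this fact: it lets
  limits taken in V be compared with limits taken in the surrounding space.\<close>

lemma tendsto_of_norm_tendsto: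
  assumes s: "\<And>n. s n \<in> V" and "v \<in> V" and lim: "(\<lambda>n. N (s n - v)) \<longlonglongrightarrow> 0"
  shows "s \<longlonglongrightarrow> v"
proof -
  have "limitin mtopology s v sequentially"
    unfolding limitin_iff using s \<open>v \<in> V\<close> order_tendstoD(2)[OF lim]
    by (simp add: eventually_sequentially)
  then have "limitin euclidean ((\<lambda>v. v) \<circ> s) v sequentially"
    using embedding unfolding embedding_continuous_def by (intro continuous_map_limit)
  then show ?thesis
    by (simp add: o_def)
qed

text \<open>Geometric tails make the partial sums Cauchy for \<open>N\<close>, completeness supplies
  a limit in V, and the embedding shows that it is also the sum in the norm of the surrounding
  space. This is how sums are later recognized as elements of V.\<close>

lemma geometric_series:
  assumes a: "\<And>k. a k \<in> V" and le: "\<And>k. N (a k) \<le> C * (1/2) ^ k"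
  shows "\<exists>v\<in>V. a sums v \<and> N v \<le> 2 * C"
proof -
  define s where "s n = (\<Sum>k<n. a k)" for n
  have sV: "s n \<in> V" for n
    unfolding s_def using a by (simp add: subspace_sum[OF subspace_V])
  have C: "0 \<le> C"
    using le[of 0] norm_nonneg[OF a[of 0]] by simp
  \<comment> \<open>The case \<open>m = 0\<close>, where \<open>s 0 = 0\<close>, also yields the
    bound \<open>2 * C\<close> for all partial sums.\<close>
  have tail: "N (s n - s m) \<le> 2 * C * (1/2) ^ m" if "m \<le> n" for m n
  proof -
    have "s n - s m = (\<Sum>k=m..<n. a k)"
      unfolding s_def by (simp add: sum_diff_nat_ivl that flip: atLeast0LessThan)
    then have "N (s n - s m) \<le> (\<Sum>k=m..<n. N (a k))"
      using norm_sum_le[of "{m..<n}" a] a by simp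
    also have "\<dots> \<le> (\<Sum>k=m..<n. C * (1/2) ^ k)"
      by (intro sum_mono le)
    also have "\<dots> = C * (\<Sum>k=m..<n. (1/2) ^ k)"
      by (simp add: sum_distrib_left)
    also have "(\<Sum>k=m..<n. (1/2) ^ k :: real) = 2 * ((1/2) ^ m - (1/2) ^ n)"
      using that by (induction n rule: dec_induct) simp_all
    also have "C * (2 * ((1/2) ^ m - (1/2) ^ n)) \<le> C * (2 * (1/2) ^ m)"
      using C by (intro mult_left_mono) auto
    finally show ?thesis by (simp add: mult_ac)
  qed
  have small: "\<exists>M. 2 * C * (1/2) ^ M < e" if "e > 0" for e
  proof -
    have "(\<lambda>M. 2 * C * (1/2) ^ M) \<longlonglongrightarrow> 0"
      by (intro tendsto_mult_right_zero LIMSEQ_realpow_zero) auto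
    then have "\<forall>\<^sub>F M in sequentially. 2 * C * (1/2) ^ M < e"
      using that by (rule order_tendstoD)
    then show ?thesis
      by (auto simp: eventually_sequentially)
  qed
  have "MCauchy s"
    unfolding MCauchy_def
  proof (intro conjI allI impI)
    show "range s \<subseteq> V" using sV by auto
    fix e :: real assume "e > 0"
    then obtain M where M: "2 * C * (1/2) ^ M < e / 2"
      using small[of "e/2"] by auto
    have "norm_dist V N (s n) (s n') < e" if "M \<le> n" "M \<le> n'" for n n'
    proof -
      have "norm_dist V N (s n) (s n') \<le> norm_dist V N (s n) (s M) + norm_dist V N (s n') (s M)"
        using triangle[of "s n" "s M" "s n'"] sV commute[of "s M" "s n'"] by simp
      also have "\<dots> < e"
        using M tail[OF that(1)] tail[OF that(2)] sV by (simp add: norm_dist_def)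
      finally show ?thesis .
    qed
    then show "\<exists>M. \<forall>n n'. M \<le> n \<longrightarrow> M \<le> n' \<longrightarrow> norm_dist V N (s n) (s n') < e"
      by blast
  qed
  then obtain v where "limitin mtopology s v sequentially"
    using mcomplete unfolding mcomplete_def by blast
  then have v: "v \<in> V" and conv: "\<And>e. e > 0 \<Longrightarrow> \<exists>M. \<forall>n\<ge>M. N (s n - v) < e"
    unfolding limitin_iff by blast+
  have nn: "0 \<le> N (s n - v)" for n
    by (intro norm_nonneg subspace_diff[OF subspace_V] sV v)
  have lim: "(\<lambda>n. N (s n - v)) \<longlonglongrightarrow> 0"
    using conv nn by (simp add: LIMSEQ_iff)
  have "a sums v"
    using tendsto_of_norm_tendsto[OF sV v lim] unfolding sums_def s_def .
  moreover have "N v \<le> 2 * C"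
  proof (rule field_le_epsilon)
    fix e :: real assume "e > 0"
    then obtain M where M: "N (s M - v) < e"
      using conv by blast
    have "N v \<le> N (s M) + N (s M - v)"
      using norm_triangle_diff[of "s M" "s M - v"] sV v by (simp add: subspace_diff[OF subspace_V])
    then show "N v \<le> 2 * C + e"
      using M tail[of 0 M] by (simp add: s_def)
  qed
  ultimately show ?thesis using v by blast
qed

section \<open>Baire category and successive approximation\<close>

text \<open>Baire's theorem puts a ball around some x into the closure of one member A. Half
  differences of points of A close to x + v and x - v approximate v, which moves the centre of the
  ball to 0.\<close>

lemma countable_cover_dense_in_ball:
  assumes "countable \<A>" and cover: "V \<subseteq> \<Union>\<A>" and sub: "\<And>A. A \<in> \<A> \<Longrightarrow> A \<subseteq> V"
    and half_diff: "\<And>A x y. A \<in> \<A> \<Longrightarrow> x \<in> A \<Longrightarrow> y \<in> A \<Longrightarrow> (1/2) *\<^sub>R (x - y) \<in> A"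
  shows "\<exists>A\<in>\<A>. \<exists>r>0. \<forall>v\<in>V. N v < r \<longrightarrow> (\<forall>e>0. \<exists>a\<in>A. N (v - a) < e)"
proof -
  have "\<exists>A\<in>\<A>. mtopology interior_of (mtopology closure_of A) \<noteq> {}"
  proof (rule ccontr)
    assume neg: "\<not> ?thesis"
    \<comment> \<open>By Baire the union of the closures would have empty interior; but it contains
      the whole nonempty space V.\<close>
    have "mtopology interior_of \<Union>((closure_of) mtopology ` \<A>) = {}"
    proof (rule metric_Baire_category_alt[OF mcomplete])
      show "countable ((closure_of) mtopology ` \<A>)"
        using assms(1) by (rule countable_image)
      show "closedin mtopology F \<and> mtopology interior_of F = {}"
        if "F \<in> (closure_of) mtopology ` \<A>" for F
        using that neg closedin_closure_of by blast
    qed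
    moreover have "V \<subseteq> \<Union>((closure_of) mtopology ` \<A>)"
    proof
      fix v assume "v \<in> V"
      then obtain A where "A \<in> \<A>" "v \<in> A"
        using cover by blast
      then show "v \<in> \<Union>((closure_of) mtopology ` \<A>)"
        using closure_of_subset[of A mtopology] sub[of A] by auto
    qed
    then have "V \<subseteq> mtopology interior_of \<Union>((closure_of) mtopology ` \<A>)"
      using openin_topspace[of mtopology] by (intro interior_of_maximal) simp_all
    ultimately have "V = {}"
      by (simp only: subset_empty)
    then show False
      using subspace_0[OF subspace_V] by blast
  qed
  then obtain A x where A: "A \<in> \<A>" and "x \<in> mtopology interior_of (mtopology closure_of A)"
    by blast
  then obtain r where "r > 0" and ball: "mball x r \<subseteq> mtopology closure_of A" and x: "x \<in> V"
    unfolding in_interior_of_mball by blast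
  note [simp] = subspace_diff[OF subspace_V] subspace_add[OF subspace_V]
  have near: "\<exists>a\<in>A. N (u - a) < e" if "u \<in> V" "N (x - u) < r" "e > 0" for u e
  proof -
    have "u \<in> mball x r"
      using that x by (simp add: norm_dist_def)
    then obtain a where "a \<in> A" "a \<in> mball u e"
      using ball \<open>e > 0\<close> unfolding metric_closure_of by blast
    then show ?thesis
      using that by (auto simp: norm_dist_def)
  qed
  have "\<exists>a\<in>A. N (v - a) < e" if v: "v \<in> V" "N v < r" and "e > 0" for v e
  proof -
    \<comment> \<open>Ensures that x + v and x - v both lie in the ball around x.\<close>
    have "N (- v) = N v"
      using norm_scaleR[OF v(1), of "-1"] by simp
    then obtain a b where a: "a \<in> A" "N (x + v - a) < e" and b: "b \<in> A" "N (x - v - b) < e"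
      using near[of "x + v" e] near[of "x - v" e] x v \<open>e > 0\<close> by auto
    have V: "a \<in> V" "b \<in> V"
      using a b sub[OF A] by auto
    have res: "x + v - a \<in> V" "x - v - b \<in> V"
      using x v V by (auto simp del: add_diff_eq)
    \<comment> \<open>The error of the half difference is half the difference of the two
      errors.\<close>
    have "v - (1/2) *\<^sub>R (a - b) = (1/2) *\<^sub>R ((x + v - a) - (x - v - b))"
      by (simp add: algebra_simps flip: scaleR_add_left)
    then have "N (v - (1/2) *\<^sub>R (a - b)) = (1/2) * N ((x + v - a) - (x - v - b))"
      using norm_scaleR[OF subspace_diff[OF subspace_V res], of "1/2"] by simp
    also have "\<dots> \<le> (1/2) * (N (x + v - a) + N (x - v - b))"
      by (intro mult_left_mono norm_triangle_diff res) simp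
    also have "\<dots> < e"
      using a b by simp
    finally show ?thesis
      using half_diff[OF A a(1) b(1)] by blast
  qed
  then show ?thesis
    using A \<open>r > 0\<close> by blast
qed

text \<open>Successive approximation as in the open mapping theorem: approximate v from A up to r/2,
  double the error so that it lies in the ball of radius r again, and repeat.\<close>

lemma dense_in_ball_expansion:
  assumes dense: "\<And>u e. u \<in> V \<Longrightarrow> N u < r \<Longrightarrow> e > 0 \<Longrightarrow> \<exists>a\<in>A. N (u - a) < e"
    and "A \<subseteq> V" "v \<in> V" "N v < r"
  shows "\<exists>a. range a \<subseteq> A \<and> (\<lambda>k. (1/2) ^ k *\<^sub>R a k) sums v"
proof -
  have r: "r > 0"
    using assms norm_nonneg[of v] by simp
  then obtain g where g: "\<And>u. u \<in> V \<Longrightarrow> N u < r \<Longrightarrow> g u \<in> A \<and> N (u - g u) < r / 2"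
    using dense[of _ "r/2"] by (metis half_gt_zero)
  \<comment> \<open>\<open>y k\<close> is the error left after k terms, rescaled by
    \<open>2 ^ k\<close>; it never leaves the ball, so \<open>g\<close> applies at every
    stage.\<close>
  define y where "y = rec_nat v (\<lambda>_ u. 2 *\<^sub>R (u - g u))"
  have y_Suc: "y (Suc k) = 2 *\<^sub>R (y k - g (y k))" for k
    by (simp add: y_def)
  have y: "y k \<in> V \<and> N (y k) < r" for k
  proof (induction k)
    case 0
    then show ?case using assms by (simp add: y_def)
  next
    case (Suc k)
    then have "y k - g (y k) \<in> V"
      using g[of "y k"] \<open>A \<subseteq> V\<close> by (auto intro: subspace_diff[OF subspace_V])
    then show ?case
      using Suc g[of "y k"] by (simp add: y_Suc norm_scaleR subspace_scale[OF subspace_V])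
  qed
  let ?a = "\<lambda>k. g (y k)"
  have aA: "?a k \<in> A" for k
    using g y by blast
  have part: "(\<Sum>k<n. (1/2) ^ k *\<^sub>R ?a k) - v = - ((1/2) ^ n) *\<^sub>R y n" for n
  proof (induction n)
    case 0
    then show ?case by (simp add: y_def)
  next
    case (Suc n)
    then show ?case
      by (simp add: y_Suc algebra_simps)
  qed
  have "(\<lambda>n. (1/2) ^ n * N (y n)) \<longlonglongrightarrow> 0"
  proof (rule Lim_null_comparison)
    show "\<forall>\<^sub>F n in sequentially. norm ((1/2) ^ n * N (y n)) \<le> (1/2) ^ n * r"
      using y norm_nonneg by (intro always_eventually) (auto simp: abs_mult less_imp_le)
    show "(\<lambda>n. (1/2) ^ n * r) \<longlonglongrightarrow> 0"
      by (intro tendsto_mult_left_zero LIMSEQ_realpow_zero) auto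
  qed
  then have "(\<lambda>n. N ((\<Sum>k<n. (1/2) ^ k *\<^sub>R ?a k) - v)) \<longlonglongrightarrow> 0"
    unfolding part using y by (simp add: norm_scaleR del: scaleR_minus_left)
  moreover have "(\<Sum>k<n. (1/2) ^ k *\<^sub>R ?a k) \<in> V" for n
    using aA \<open>A \<subseteq> V\<close> by (auto intro!: subspace_sum[OF subspace_V] subspace_scale[OF subspace_V])
  ultimately have "(\<lambda>k. (1/2) ^ k *\<^sub>R ?a k) sums v"
    unfolding sums_def using \<open>v \<in> V\<close> by (intro tendsto_of_norm_tendsto)
  then show ?thesis
    using aA by (intro exI[of _ ?a]) auto
qed

section \<open>Uniform boundedness\<close>

text \<open>The operators are continuous only for the norm of the surrounding space and need not map
  V into V beforehand. Hence invariance and the bound have to be derived together from the category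
  argument.\<close>

theorem pointwise_bounded_imp_uniformly_bounded:
  fixes T :: "'i \<Rightarrow> 'a \<Rightarrow> 'a" and J :: "nat \<Rightarrow> 'i set" and w :: "'i \<Rightarrow> real"
  assumes lin: "\<And>n i. i \<in> J n \<Longrightarrow> bounded_linear (T i)"
    and w: "\<And>n i. i \<in> J n \<Longrightarrow> 0 \<le> w i"
    and pw: "\<And>v. v \<in> V \<Longrightarrow> \<exists>n m. \<forall>i\<in>J n. T i v \<in> V \<and> N (T i v) \<le> m * w i"
  shows "\<exists>n M. 0 \<le> M \<and> (\<forall>i\<in>J n. \<forall>v\<in>V. T i v \<in> V \<and> N (T i v) \<le> M * w i * N v)"
proof -
  \<comment> \<open>Natural numbers as bounds keep the family countable; a real bound can be rounded
    up because \<open>w\<close> is nonnegative.\<close>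
  define A where
    "A n m = {v \<in> V. \<forall>i\<in>J n. T i v \<in> V \<and> N (T i v) \<le> real m * w i}" for n m
  have half_diff: "(1/2) *\<^sub>R (x - y) \<in> A n m" if "x \<in> A n m" "y \<in> A n m" for n m x y
  proof -
    have "T i ((1/2) *\<^sub>R (x - y)) \<in> V \<and> N (T i ((1/2) *\<^sub>R (x - y))) \<le> real m * w i"
      if i: "i \<in> J n" for i
    proof -
      interpret bounded_linear "T i" using lin[OF i] .
      have "T i x \<in> V" "T i y \<in> V" "N (T i x) \<le> real m * w i" "N (T i y) \<le> real m * w i"
        using \<open>x \<in> A n m\<close> \<open>y \<in> A n m\<close> i by (auto simp: A_def)
      moreover from this have "T i x - T i y \<in> V"
        using subspace_diff[OF subspace_V] by blast
      ultimately show ?thesis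
        using norm_triangle_diff[of "T i x" "T i y"]
        by (simp add: scaleR diff norm_scaleR subspace_scale[OF subspace_V])
    qed
    moreover have "(1/2) *\<^sub>R (x - y) \<in> V"
      using that by (auto simp: A_def intro!: subspace_scale[OF subspace_V] subspace_diff[OF subspace_V])
    ultimately show ?thesis
      by (simp add: A_def)
  qed
  have cover: "\<exists>n m. v \<in> A n m" if v: "v \<in> V" for v
  proof -
    obtain n m where nm: "\<forall>i\<in>J n. T i v \<in> V \<and> N (T i v) \<le> m * w i"
      using pw[OF v] by blast
    obtain m' where m': "m \<le> real m'"
      using real_arch_simple by blast
    have "N (T i v) \<le> real m' * w i" if "i \<in> J n" for i
      using nm that mult_right_mono[OF m' w[OF that]] by force
    then show ?thesis
      using nm v unfolding A_def by blast
  qed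
  let ?\<A> = "range (case_prod A)"
  have "\<exists>B\<in>?\<A>. \<exists>r>0. \<forall>v\<in>V. N v < r \<longrightarrow> (\<forall>e>0. \<exists>a\<in>B. N (v - a) < e)"
  proof (rule countable_cover_dense_in_ball)
    show "countable ?\<A>" by simp
    show "V \<subseteq> \<Union>?\<A>" using cover by auto
    show "B \<subseteq> V" if "B \<in> ?\<A>" for B
      using that by (auto simp: A_def)
    show "(1/2) *\<^sub>R (x - y) \<in> B" if "B \<in> ?\<A>" "x \<in> B" "y \<in> B" for B x y
      using that half_diff by auto
  qed
  then obtain n m r where r: "r > 0"
    and dense: "\<And>v e. v \<in> V \<Longrightarrow> N v < r \<Longrightarrow> e > 0 \<Longrightarrow> \<exists>a\<in>A n m. N (v - a) < e"
    by (force simp: image_iff)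
  have ball: "T i v \<in> V \<and> N (T i v) \<le> 2 * (real m * w i)"
    if i: "i \<in> J n" and v: "v \<in> V" "N v < r" for i v
  proof -
    interpret bounded_linear "T i" using lin[OF i] .
    have "A n m \<subseteq> V" by (auto simp: A_def)
    from dense_in_ball_expansion[OF dense this v] obtain a
      where a: "range a \<subseteq> A n m" and "(\<lambda>k. (1/2) ^ k *\<^sub>R a k) sums v"
      by blast
    \<comment> \<open>Termwise application is justified by continuity in the surrounding space; at
      this point the sum is not yet known to lie in V.\<close>
    then have sums: "(\<lambda>k. (1/2) ^ k *\<^sub>R T i (a k)) sums T i v"
      using sums[of "\<lambda>k. (1/2) ^ k *\<^sub>R a k"] by (simp add: scaleR)
    have Ta: "T i (a k) \<in> V" "N (T i (a k)) \<le> real m * w i" for k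
      using a i by (auto simp: A_def)
    have "\<exists>u\<in>V. (\<lambda>k. (1/2) ^ k *\<^sub>R T i (a k)) sums u \<and> N u \<le> 2 * (real m * w i)"
    proof (rule geometric_series)
      show "(1/2) ^ k *\<^sub>R T i (a k) \<in> V" for k
        using Ta by (simp add: subspace_scale[OF subspace_V])
      show "N ((1/2) ^ k *\<^sub>R T i (a k)) \<le> real m * w i * (1/2) ^ k" for k
        using Ta[of k] by (simp add: norm_scaleR divide_right_mono power_one_over)
    qed
    \<comment> \<open>The limit found in V equals \<open>T i v\<close> because limits in the
      surrounding space are unique.\<close>
    then show ?thesis
      using sums sums_unique2 by blast
  qed
  have "T i v \<in> V \<and> N (T i v) \<le> 4 * real m / r * w i * N v"
    if i: "i \<in> J n" and v: "v \<in> V" for i v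
  proof (cases "v = 0")
    case True
    then show ?thesis
      using linear_simps(3)[OF lin[OF i]] subspace_0[OF subspace_V] norm_eq_0[of 0]
      by simp
  next
    case False
    interpret bounded_linear "T i" using lin[OF i] .
    have pos: "N v > 0"
      using False v norm_eq_0 norm_nonneg by force
    \<comment> \<open>This scaling gives \<open>t *\<^sub>R v\<close> the norm r/2, inside the ball;
      dividing the bound \<open>2 * (real m * w i)\<close> by t produces the factor
      \<open>4 * real m / r\<close>.\<close>
    define t where "t = r / (2 * N v)"
    have t: "t > 0" using r pos by (simp add: t_def)
    have "N (t *\<^sub>R v) < r"
      using r pos v t by (simp add: norm_scaleR) (simp add: t_def)
    then have *: "t *\<^sub>R T i v \<in> V" "N (t *\<^sub>R T i v) \<le> 2 * (real m * w i)"
      using ball[OF i, of "t *\<^sub>R v"] v by (simp_all add: scaleR subspace_scale[OF subspace_V])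
    then have V: "T i v \<in> V"
      using subspace_scale[OF subspace_V, of "t *\<^sub>R T i v" "1/t"] t by simp
    have "t * N (T i v) \<le> 2 * (real m * w i)"
      using * V t by (simp add: norm_scaleR)
    then show ?thesis
      using V r pos by (simp add: t_def field_simps)
  qed
  then show ?thesis
    using r by (intro exI[of _ n] exI[of _ "4 * real m / r"]) auto
qed

end

section \<open>Reduction to real scalars and the equivalence\<close>

lemma bounded_linear_of_bounded_operator_over:
  assumes "banach_space_over smul" "bounded_operator_over smul f"
  shows "bounded_linear f"
proof -
  interpret Vector_Spaces.linear smul smul f
    using assms(2) by (simp add: bounded_operator_over_def)
  obtain C where "\<And>x. norm (f x) \<le> C * norm x"
    using assms(2) unfolding bounded_operator_over_def by blast
  then show ?thesis
    using assms(1) scale[of "of_real _"]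
    by (intro bounded_linear_intro[of f C]) (simp_all add: add mult.commute banach_space_over_def)
qed

text \<open>Restricting scalars to the reals changes neither \<open>N\<close> nor its metric, so
  completeness and continuity carry over; only homogeneity has to be checked again.\<close>

lemma embedded_banach_of_operator_range:
  fixes smul :: "'k::{real_normed_field,banach} \<Rightarrow> 'a::banach \<Rightarrow> 'a"
  assumes E: "banach_space_over smul" and "operator_range smul V"
    and N: "complete_norm_on smul V N" and "embedding_continuous V N"
  shows "embedded_banach V N"
proof
  interpret vector_space smul
    using E by (simp add: banach_space_over_def)
  have smul_of_real: "smul (of_real r) x = r *\<^sub>R x" for r x
    using E by (simp add: banach_space_over_def)
  have V: "subspace V"
    using assms(2) by (simp add: operator_range_def)
  show "Real_Vector_Spaces.subspace V"
    unfolding Real_Vector_Spaces.subspace_def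
    using subspace_0[OF V] subspace_add[OF V] subspace_scale[OF V] smul_of_real by metis
  have "N (r *\<^sub>R v) = \<bar>r\<bar> * N v" if "v \<in> V" for r v
    using N that unfolding complete_norm_on_def norm_on_def
    by (metis norm_of_real smul_of_real)
  then show "complete_norm_on (*\<^sub>R) V N"
    using N by (simp add: complete_norm_on_def norm_on_def)
  show "embedding_continuous V N" by fact
qed

theorem corollary2p7:
  fixes smul :: "'k::{real_normed_field,banach} \<Rightarrow> 'a::banach \<Rightarrow> 'a"
    and I :: "'i set" and le :: "'i \<Rightarrow> 'i \<Rightarrow> bool"
    and T :: "'i \<Rightarrow> 'a \<Rightarrow> 'a"
    and V :: "'a set" and normV :: "'a \<Rightarrow> real"
  assumes "banach_space_over smul"
    and "directed_set I le"
    and "\<exists>B. countable B \<and> majorizing I le B"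
    and "\<forall>i\<in>I. bounded_operator_over smul (T i)"
    and "operator_range smul V"
    and "complete_norm_on smul V normV"
    and "embedding_continuous V normV"
  shows "uniformly_eventually_invariant I le T V \<longleftrightarrow>
    (\<exists>c :: 'i \<Rightarrow> real. (\<forall>i\<in>I. 0 \<le> c i) \<and>
       (\<forall>v\<in>V. \<exists>i0\<in>I. \<forall>i\<in>I. le i0 i \<longrightarrow>
          T i v \<in> V \<and> normV (T i v) \<le> c i * normV v))"
proof
  interpret embedded_banach V normV
    using assms by (intro embedded_banach_of_operator_range)
  have lin: "bounded_linear (T i)" if "i \<in> I" for i
    using assms(1,4) that bounded_linear_of_bounded_operator_over by blast
  {
    assume "uniformly_eventually_invariant I le T V"
    then obtain i0 where i0: "i0 \<in> I" and inv: "\<And>i. i \<in> I \<Longrightarrow> le i0 i \<Longrightarrow> T i ` V \<subseteq> V"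
      unfolding uniformly_eventually_invariant_def by blast
    \<comment> \<open>The constant must exist for every index, so the claim is made vacuous for
      indices not above \<open>i0\<close>.\<close>
    have "\<exists>M\<ge>0. le i0 i \<longrightarrow> (\<forall>v\<in>V. normV (T i v) \<le> M * normV v)" if i: "i \<in> I" for i
    proof (cases "le i0 i")
      case True
      have "\<exists>(n::nat) M. 0 \<le> M \<and> (\<forall>j\<in>{i}. \<forall>v\<in>V. T j v \<in> V \<and> normV (T j v) \<le> M * 1 * normV v)"
      \<comment> \<open>For a single operator the pointwise hypothesis is just invariance, with
        \<open>normV (T i v)\<close> as the constant for v.\<close>
      proof (rule pointwise_bounded_imp_uniformly_bounded[of "\<lambda>_. {i}" T "\<lambda>_. 1"])
        show "bounded_linear (T j)" if "j \<in> {i}" for j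
          using that lin[OF i] by simp
        show "\<exists>(n::nat) m. \<forall>j\<in>{i}. T j v \<in> V \<and> normV (T j v) \<le> m * 1" if "v \<in> V" for v
          using inv[OF i True] that by auto
      qed simp
      then show ?thesis by auto
    qed auto
    then obtain c where c: "\<And>i. i \<in> I \<Longrightarrow> 0 \<le> c i"
      and le: "\<And>i v. i \<in> I \<Longrightarrow> le i0 i \<Longrightarrow> v \<in> V \<Longrightarrow> normV (T i v) \<le> c i * normV v"
      by metis
    have "\<exists>i0\<in>I. \<forall>i\<in>I. le i0 i \<longrightarrow> T i v \<in> V \<and> normV (T i v) \<le> c i * normV v" if "v \<in> V" for v
      using i0 inv le that by blast
    with c show "\<exists>c. (\<forall>i\<in>I. 0 \<le> c i) \<and> (\<forall>v\<in>V. \<exists>i0\<in>I. \<forall>i\<in>I. le i0 i \<longrightarrow>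
        T i v \<in> V \<and> normV (T i v) \<le> c i * normV v)"
      by blast
  next
    assume "\<exists>c. (\<forall>i\<in>I. 0 \<le> c i) \<and> (\<forall>v\<in>V. \<exists>i0\<in>I. \<forall>i\<in>I. le i0 i \<longrightarrow>
        T i v \<in> V \<and> normV (T i v) \<le> c i * normV v)"
    then obtain c where c: "\<And>i. i \<in> I \<Longrightarrow> 0 \<le> c i"
      and ev: "\<And>v. v \<in> V \<Longrightarrow> \<exists>i0\<in>I. \<forall>i\<in>I. le i0 i \<longrightarrow>
        T i v \<in> V \<and> normV (T i v) \<le> c i * normV v"
      by blast
    obtain B where "countable B" and B: "B \<subseteq> I" "\<And>i. i \<in> I \<Longrightarrow> \<exists>b\<in>B. le i b"
      using assms(3) unfolding majorizing_def by blast
    have "I \<noteq> {}" and trans: "\<And>i j k. i \<in> I \<Longrightarrow> j \<in> I \<Longrightarrow> k \<in> I \<Longrightarrow> le i j \<Longrightarrow> le j k \<Longrightarrow> le i k"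
      using assms(2) unfolding directed_set_def transp_on_def by blast+
    then have "B \<noteq> {}" using B by blast
    \<comment> \<open>An enumeration of the majorizing set, possibly with repetitions, so that the
      index sets \<open>?J n\<close> form a sequence.\<close>
    define b where "b = from_nat_into B"
    have b: "range b = B"
      unfolding b_def using \<open>B \<noteq> {}\<close> \<open>countable B\<close> by (rule range_from_nat_into)
    then have bI: "b n \<in> I" for n using B by blast
    let ?J = "\<lambda>n. {i \<in> I. le (b n) i}"
    have "\<exists>n M. 0 \<le> M \<and> (\<forall>i\<in>?J n. \<forall>v\<in>V. T i v \<in> V \<and> normV (T i v) \<le> M * c i * normV v)"
    proof (rule pointwise_bounded_imp_uniformly_bounded)
      show "bounded_linear (T i)" if "i \<in> ?J n" for n i
        using that lin by simp
      show "0 \<le> c i" if "i \<in> ?J n" for n i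
        using that c by simp
      fix v assume "v \<in> V"
      then obtain i0 where i0: "i0 \<in> I"
        and *: "\<And>i. i \<in> I \<Longrightarrow> le i0 i \<Longrightarrow> T i v \<in> V \<and> normV (T i v) \<le> c i * normV v"
        using ev by blast
      obtain n where "le i0 (b n)"
        using B(2)[OF i0] b by blast
      \<comment> \<open>Passing from \<open>i0\<close> to a majorizing \<open>b n\<close> leaves
        only countably many index sets; the constant for v is \<open>normV v\<close>.\<close>
      then have "\<forall>i\<in>?J n. T i v \<in> V \<and> normV (T i v) \<le> normV v * c i"
        using * trans[OF i0 bI] by (simp add: mult.commute)
      then show "\<exists>n m. \<forall>i\<in>?J n. T i v \<in> V \<and> normV (T i v) \<le> m * c i"
        by blast
    qed
    \<comment> \<open>The index \<open>b n\<close> now works for all v simultaneously; only the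
      membership part of the conclusion is kept.\<close>
    then show "uniformly_eventually_invariant I le T V"
      unfolding uniformly_eventually_invariant_def using bI by blast
  }
qed

end
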